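(* Let $G$ be a Lie group and let $\pi$ be a Poisson 2-tensor on $G$. Let $H$ be a closed Lie subgroup of $G$ and let $\sigma\in G$. Define the 2-tensor $\pi_\sigma$ on $G$ by $\pi_\sigma(g):=R_\sigma\big(\pi(g\sigma^{-1})\big)$ for $g\in G$. Then the conjugate subgroup $\operatorname{Ad}_\sigma H=\sigma H\sigma^{-1}$ is $\pi$-coisotropic if and only if $H$ is $\pi_\sigma$-coisotropic.
   Context: Let $\mathfrak g$ be the Lie algebra of $G$. For $g\in G$, $L_g$ and $R_g$ denote left and right translation by $g$ on $G$, and also the induced maps (differentials) on tangent vectors and multivectors. A Poisson 2-tensor is a smooth bivector field $\rho$ with vanishing Schouten bracket with itself. For a subalgebra $\mathfrak h\subseteq\mathfrak g$, $\mathfrak h\wedge\mathfrak g\subseteq\wedge^2\mathfrak g$ is the span of the elements $x\wedge y$ with $x\in\mathfrak h$, $y\in\mathfrak g$. Given a 2-tensor $\rho$ on $G$, a closed subgroup $H\subseteq G$ with Lie algebra $\mathfrak h$ is called $\rho$-coisotropic (a $\rho$-coisotropic subgroup) if $\rho(gh)-R_h(\rho(g))\in L_{gh}(\mathfrak h\wedge\mathfrak g)$ for all $g\in G$ and $h\in H$. *)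

theory Defs
  imports "HOL-Analysis.Analysis" "HOL-Library.Function_Algebras" "HOL-Algebra.Group"
begin

instantiation "fun" :: (type, real_vector) real_vector
begin

definition scaleR_fun_def: "scaleR c f = (\<lambda>x. scaleR c (f x))"

instance
  by standard (auto simp: scaleR_fun_def fun_eq_iff algebra_simps)

end

lemma scaleR_fun_apply [simp]: "(c *\<^sub>R f) x = c *\<^sub>R f x"
  by (simp add: scaleR_fun_def)


section \<open>Smooth manifolds\<close>

text \<open>
  \<open>k\<close>-fold continuous differentiability, to be used on open sets in finite-dimensional spaces:
  for \<open>k > 0\<close>, the function is Frechet differentiable and all its directional derivatives
  are of class \<open>k - 1\<close>.
\<close>

primrec k_smooth_on ::
    "nat \<Rightarrow> 'e::real_normed_vector set \<Rightarrow> ('e \<Rightarrow> 'f::real_normed_vector) \<Rightarrow> bool" where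
  "k_smooth_on 0 S f \<longleftrightarrow> continuous_on S f"
| "k_smooth_on (Suc k) S f \<longleftrightarrow>
     (\<forall>x\<in>S. f differentiable (at x)) \<and>
     (\<forall>v. k_smooth_on k S (\<lambda>x. frechet_derivative f (at x) v))"

definition smooth_on :: "'e::real_normed_vector set \<Rightarrow> ('e \<Rightarrow> 'f::real_normed_vector) \<Rightarrow> bool" where
  "smooth_on S f \<longleftrightarrow> (\<forall>k. k_smooth_on k S f)"

record ('a, 'e) manifold =
  topology_of :: "'a topology"
  atlas :: "('a set \<times> ('a \<Rightarrow> 'e)) set"

text \<open>
  The model space \<open>'e\<close> is a finite-dimensional normed space rather than a Euclidean space in the
  sense of the type class, since the latter would exclude manifolds of dimension \<open>0\<close>.
  Atlases need not be maximal.
\<close>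

definition smooth_manifold :: "('a, 'e::real_normed_vector) manifold \<Rightarrow> bool" where
  "smooth_manifold M \<longleftrightarrow>
     (\<exists>B::'e set. finite B \<and> span B = UNIV) \<and>
     Hausdorff_space (topology_of M) \<and>
     second_countable (topology_of M) \<and>
     (\<Union>(U, \<phi>)\<in>atlas M. U) = topspace (topology_of M) \<and>
     (\<forall>(U, \<phi>)\<in>atlas M. openin (topology_of M) U \<and> open (\<phi> ` U) \<and>
        homeomorphic_map (subtopology (topology_of M) U) (top_of_set (\<phi> ` U)) \<phi>) \<and>
     (\<forall>(U, \<phi>)\<in>atlas M. \<forall>(V, \<psi>)\<in>atlas M. smooth_on (\<phi> ` (U \<inter> V)) (\<psi> \<circ> inv_into U \<phi>))"

definition smooth_map ::
    "('a, 'e::real_normed_vector) manifold \<Rightarrow> ('b, 'f::real_normed_vector) manifold \<Rightarrow>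
     ('a \<Rightarrow> 'b) \<Rightarrow> bool" where
  "smooth_map M N F \<longleftrightarrow>
     continuous_map (topology_of M) (topology_of N) F \<and>
     (\<forall>(U, \<phi>)\<in>atlas M. \<forall>(V, \<psi>)\<in>atlas N.
        smooth_on (\<phi> ` (U \<inter> F -` V)) (\<psi> \<circ> F \<circ> inv_into U \<phi>))"

definition euclidean_manifold :: "('e::real_normed_vector, 'e) manifold" where
  "euclidean_manifold = \<lparr>topology_of = euclidean, atlas = {(UNIV, id)}\<rparr>"

definition prod_manifold ::
    "('a, 'e) manifold \<Rightarrow> ('b, 'f) manifold \<Rightarrow> ('a \<times> 'b, 'e \<times> 'f) manifold" where
  "prod_manifold M N =
     \<lparr>topology_of = prod_topology (topology_of M) (topology_of N),
      atlas = {(U \<times> V, map_prod \<phi> \<psi>) | U \<phi> V \<psi>. (U, \<phi>) \<in> atlas M \<and> (V, \<psi>) \<in> atlas N}\<rparr>"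

text \<open>
  Values of \<open>f\<close> outside the manifold are irrelevant for \<open>f \<in> smooth_functions M\<close>, and the
  Leibniz rule forces tangent vectors to ignore them: if \<open>f\<close> vanishes on \<open>M\<close>, then \<open>f = f * e\<close>
  where \<open>e\<close> is \<open>0\<close> on \<open>M\<close> and \<open>1\<close> elsewhere, so that \<open>X f = f p * X e + X f * e p = 0\<close>.
\<close>

definition smooth_functions :: "('a, 'e::real_normed_vector) manifold \<Rightarrow> ('a \<Rightarrow> real) set" where
  "smooth_functions M = {f. smooth_map M euclidean_manifold f}"


section \<open>Tangent vectors and bivectors\<close>

text \<open>
  Tangent vectors at \<open>p\<close> are derivations at \<open>p\<close> of the algebra of smooth functions. They are
  extended by \<open>0\<close> to all functions, so that tangent vectors are equal as soon as they agree on the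
  smooth functions.
\<close>

type_synonym 'a vec = "('a \<Rightarrow> real) \<Rightarrow> real"

definition tangent_space :: "('a, 'e::real_normed_vector) manifold \<Rightarrow> 'a \<Rightarrow> 'a vec set" where
  "tangent_space M p =
     {X. (\<forall>f. f \<notin> smooth_functions M \<longrightarrow> X f = 0) \<and>
         (\<forall>f\<in>smooth_functions M. \<forall>g\<in>smooth_functions M. X (f + g) = X f + X g) \<and>
         (\<forall>c. \<forall>f\<in>smooth_functions M. X (c *\<^sub>R f) = c * X f) \<and>
         (\<forall>f\<in>smooth_functions M. \<forall>g\<in>smooth_functions M. X (f * g) = f p * X g + X f * g p)}"

definition velocity :: "('a, 'e::real_normed_vector) manifold \<Rightarrow> (real \<Rightarrow> 'a) \<Rightarrow> 'a vec" where
  "velocity M \<gamma> = (\<lambda>f. if f \<in> smooth_functions M then deriv (\<lambda>t. f (\<gamma> t)) 0 else 0)"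

text \<open>
  Elements of the exterior square of a tangent space are represented by the alternating forms
  \<open>(f, g) \<mapsto> B(df, dg)\<close> that they induce; \<open>X \<and> Y\<close> becomes
  \<open>(f, g) \<mapsto> X f * Y g - X g * Y f\<close>. This representation is injective, and the
  exterior square is recovered as the span of the decomposable elements.
\<close>

type_synonym 'a bivec = "('a \<Rightarrow> real) \<Rightarrow> ('a \<Rightarrow> real) \<Rightarrow> real"

definition wedge :: "'a vec \<Rightarrow> 'a vec \<Rightarrow> 'a bivec" where
  "wedge X Y = (\<lambda>f g. X f * Y g - X g * Y f)"

definition wedge_space :: "'a vec set \<Rightarrow> 'a vec set \<Rightarrow> 'a bivec set" where
  "wedge_space V W = span {wedge X Y | X Y. X \<in> V \<and> Y \<in> W}"

definition push_vec :: "('a, 'e::real_normed_vector) manifold \<Rightarrow> ('a \<Rightarrow> 'a) \<Rightarrow> 'a vec \<Rightarrow> 'a vec" where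
  "push_vec M F X = (\<lambda>f. if f \<in> smooth_functions M then X (f \<circ> F) else 0)"

definition push_bivec ::
    "('a, 'e::real_normed_vector) manifold \<Rightarrow> ('a \<Rightarrow> 'a) \<Rightarrow> 'a bivec \<Rightarrow> 'a bivec" where
  "push_bivec M F B =
     (\<lambda>f g. if f \<in> smooth_functions M \<and> g \<in> smooth_functions M then B (f \<circ> F) (g \<circ> F) else 0)"

lemma push_bivec_wedge: "push_bivec M F (wedge X Y) = wedge (push_vec M F X) (push_vec M F Y)"
  by (auto simp: push_bivec_def push_vec_def wedge_def fun_eq_iff)

definition bivector_field :: "('a, 'e::real_normed_vector) manifold \<Rightarrow> ('a \<Rightarrow> 'a bivec) \<Rightarrow> bool" where
  "bivector_field M \<rho> \<longleftrightarrow>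
     (\<forall>p\<in>topspace (topology_of M). \<rho> p \<in> wedge_space (tangent_space M p) (tangent_space M p)) \<and>
     (\<forall>f\<in>smooth_functions M. \<forall>g\<in>smooth_functions M. (\<lambda>p. \<rho> p f g) \<in> smooth_functions M)"

text \<open>
  Schouten bracket of two bivector fields, as an alternating triderivation. For
  \<open>P = X\<^sub>1 \<and> X\<^sub>2\<close> and \<open>Q = Y\<^sub>1 \<and> Y\<^sub>2\<close> it is, up to an overall sign that depends on conventions,
  the sum over \<open>i\<close> and \<open>j\<close> of \<open>(-1)\<^sup>i\<^sup>+\<^sup>j [X\<^sub>i, Y\<^sub>j] \<and> X\<^sub>3\<^sub>-\<^sub>i \<and> Y\<^sub>3\<^sub>-\<^sub>j\<close>.
\<close>

definition schouten_bracket ::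
    "('a \<Rightarrow> 'a bivec) \<Rightarrow> ('a \<Rightarrow> 'a bivec) \<Rightarrow>
     'a \<Rightarrow> ('a \<Rightarrow> real) \<Rightarrow> ('a \<Rightarrow> real) \<Rightarrow> ('a \<Rightarrow> real) \<Rightarrow> real" where
  "schouten_bracket P Q p f g h =
     P p (\<lambda>q. Q q f g) h + P p (\<lambda>q. Q q g h) f + P p (\<lambda>q. Q q h f) g +
     Q p (\<lambda>q. P q f g) h + Q p (\<lambda>q. P q g h) f + Q p (\<lambda>q. P q h f) g"

definition poisson_tensor :: "('a, 'e::real_normed_vector) manifold \<Rightarrow> ('a \<Rightarrow> 'a bivec) \<Rightarrow> bool" where
  "poisson_tensor M \<rho> \<longleftrightarrow>
     bivector_field M \<rho> \<and>
     (\<forall>p\<in>topspace (topology_of M).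
        \<forall>f\<in>smooth_functions M. \<forall>g\<in>smooth_functions M. \<forall>h\<in>smooth_functions M.
          schouten_bracket \<rho> \<rho> p f g h = 0)"


section \<open>Lie groups and coisotropic subgroups\<close>

locale lie_group = group G
  for G (structure) and M :: "('a, 'e::real_normed_vector) manifold" +
  assumes manifold: "smooth_manifold M"
    and topspace_eq: "topspace (topology_of M) = carrier G"
    and smooth_mult: "smooth_map (prod_manifold M M) M (\<lambda>(x, y). x \<otimes> y)"
    and smooth_inv: "smooth_map M M (\<lambda>x. inv x)"

definition left_translation ::
    "('a, 'm) monoid_scheme \<Rightarrow> ('a, 'e::real_normed_vector) manifold \<Rightarrow> 'a \<Rightarrow> 'a bivec \<Rightarrow> 'a bivec" where
  "left_translation G M g = push_bivec M (\<lambda>x. g \<otimes>\<^bsub>G\<^esub> x)"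

definition right_translation ::
    "('a, 'm) monoid_scheme \<Rightarrow> ('a, 'e::real_normed_vector) manifold \<Rightarrow> 'a \<Rightarrow> 'a bivec \<Rightarrow> 'a bivec" where
  "right_translation G M g = push_bivec M (\<lambda>x. x \<otimes>\<^bsub>G\<^esub> g)"

text \<open>
  For a closed subgroup \<open>H\<close>, the curves below are precisely the smooth curves in the embedded
  submanifold \<open>H\<close> starting at the identity, so this is the tangent space of \<open>H\<close> at the identity
  as a subspace of the Lie algebra \<open>tangent_space M \<one>\<^bsub>G\<^esub>\<close> of \<open>G\<close>.
\<close>

definition lie_algebra_of ::
    "('a, 'm) monoid_scheme \<Rightarrow> ('a, 'e::real_normed_vector) manifold \<Rightarrow> 'a set \<Rightarrow> 'a vec set" where
  "lie_algebra_of G M H =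
     {velocity M \<gamma> | \<gamma>. smooth_map euclidean_manifold M \<gamma> \<and> \<gamma> 0 = \<one>\<^bsub>G\<^esub> \<and> range \<gamma> \<subseteq> H}"

definition closed_subgroup ::
    "('a, 'm) monoid_scheme \<Rightarrow> ('a, 'e::real_normed_vector) manifold \<Rightarrow> 'a set \<Rightarrow> bool" where
  "closed_subgroup G M H \<longleftrightarrow> subgroup H G \<and> closedin (topology_of M) H"

definition coisotropic_subgroup ::
    "('a, 'm) monoid_scheme \<Rightarrow> ('a, 'e::real_normed_vector) manifold \<Rightarrow> ('a \<Rightarrow> 'a bivec) \<Rightarrow>
     'a set \<Rightarrow> bool" where
  "coisotropic_subgroup G M \<rho> H \<longleftrightarrow>
     closed_subgroup G M H \<and>
     (\<forall>g\<in>carrier G. \<forall>h\<in>H.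
        \<rho> (g \<otimes>\<^bsub>G\<^esub> h) - right_translation G M h (\<rho> g) \<in>
          left_translation G M (g \<otimes>\<^bsub>G\<^esub> h) `
            wedge_space (lie_algebra_of G M H) (tangent_space M \<one>\<^bsub>G\<^esub>))"

definition twist ::
    "('a, 'm) monoid_scheme \<Rightarrow> ('a, 'e::real_normed_vector) manifold \<Rightarrow> ('a \<Rightarrow> 'a bivec) \<Rightarrow>
     'a \<Rightarrow> 'a \<Rightarrow> 'a bivec" where
  "twist G M \<pi> \<sigma> = (\<lambda>g. right_translation G M \<sigma> (\<pi> (g \<otimes>\<^bsub>G\<^esub> inv\<^bsub>G\<^esub> \<sigma>)))"

end

(*
  Write c(h) = \<sigma>h\<sigma>\<inverse> and g = k\<sigma>\<inverse>. Applying R\<^sub>\<sigma> to \<pi>(g c(h)) - R_{c(h)} \<pi>(g) gives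
  \<pi>\<^sub>\<sigma>(kh) - R_h \<pi>\<^sub>\<sigma>(k), while R\<^sub>\<sigma> L_{g c(h)} = L_{kh} Ad_{\<sigma>\<inverse>}, and Ad_{\<sigma>\<inverse>} maps the Lie
  algebra of \<sigma>H\<sigma>\<inverse> into that of H. This is one implication; the other is the same statement
  for \<pi>\<^sub>\<sigma>, \<sigma>H\<sigma>\<inverse> and \<sigma>\<inverse>, because twisting \<pi>\<^sub>\<sigma> by \<sigma>\<inverse> gives back \<pi>.
  What remains is that push-forward is functorial, which rests on the chain rule for smooth maps
  between manifolds. Its inductive proof expands derivatives in a basis of the model space, whose
  coordinate functionals have to be shown bounded.
*)
theory Submission
  imports Defs
begin

section \<open>Finite-dimensional normed spaces\<close>

text \<open>Equivalence of the l1 norm of the coordinates with the given norm, by induction on the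
  basis. A new vector \<open>a\<close> has positive distance \<open>d\<close> from the span of the
  others, which bounds its coefficient; subtracting its contribution reduces the other coefficients
  to the induction hypothesis.\<close>

lemma independent_coordinates_bounded:
  fixes B :: "'a::real_normed_vector set"
  assumes "finite B" "independent B"
  shows "\<exists>K. \<forall>c. (\<Sum>b\<in>B. \<bar>c b\<bar>) \<le> K * norm (\<Sum>b\<in>B. c b *\<^sub>R b)"
  using assms
proof (induction B rule: finite_induct)
  case empty
  then show ?case by simp
next
  case (insert a B)
  have indep: "independent B" and a: "a \<notin> span B"
    using insert.prems insert.hyps by (auto simp: independent_insert)
  obtain K0 where K0: "\<And>c. (\<Sum>b\<in>B. \<bar>c b\<bar>) \<le> K0 * norm (\<Sum>b\<in>B. c b *\<^sub>R b)"
    using insert.IH[OF indep] by auto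
  \<comment> \<open>For empty \<open>B\<close> the constant \<open>K0\<close> may be negative, while
    the estimates below multiply inequalities by \<open>K\<close>.\<close>
  define K where "K = \<bar>K0\<bar>"
  have "K \<ge> 0" by (simp add: K_def)
  have K: "(\<Sum>b\<in>B. \<bar>c b\<bar>) \<le> K * norm (\<Sum>b\<in>B. c b *\<^sub>R b)" for c
    using order_trans[OF K0[of c] mult_right_mono[OF abs_ge_self norm_ge_zero]]
    by (simp add: K_def)
  \<comment> \<open>The bound on \<open>B\<close> makes \<open>span B\<close> closed, so \<open>a\<close> has positive distance from it.\<close>
  obtain d where "d > 0" and d: "\<And>y. y \<in> span B \<Longrightarrow> d \<le> norm (a + y)"
  proof (rule ccontr)
    assume "\<not> thesis"
    then have "\<exists>y\<in>span B. norm (a + y) < d" if "d > 0" for d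
      using that \<open>\<And>d. 0 < d \<Longrightarrow> (\<And>y. y \<in> span B \<Longrightarrow> d \<le> norm (a + y)) \<Longrightarrow> thesis\<close>
      by (meson not_le)
    \<comment> \<open>At distance 0, a sequence in \<open>span B\<close> tends to
      \<open>- a\<close>. By the bound \<open>K\<close> its coordinates are Cauchy, and their limits
      express \<open>- a\<close> in terms of \<open>B\<close>, against
      \<open>a \<notin> span B\<close>.\<close>
    then have "\<forall>n. \<exists>y\<in>span B. norm (a + y) < inverse (real (Suc n))"
      by simp
    then obtain y where yB: "\<And>n. y n \<in> span B" and y: "\<And>n. norm (a + y n) < inverse (real (Suc n))"
      by metis
    have "(\<lambda>n. a + y n) \<longlonglongrightarrow> 0"
      by (rule Lim_null_comparison[OF _ LIMSEQ_inverse_real_of_nat])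
        (use y in \<open>auto intro!: always_eventually less_imp_le\<close>)
    from tendsto_add[OF this tendsto_const[of "- a"]] have lim: "y \<longlonglongrightarrow> - a"
      by simp
    have "\<forall>n. \<exists>c. y n = (\<Sum>b\<in>B. c b *\<^sub>R b)"
      using yB span_finite[OF insert.hyps(1)] by fastforce
    then obtain c where c: "\<And>n. y n = (\<Sum>b\<in>B. c n b *\<^sub>R b)"
      by metis
    have "Cauchy y"
      using lim by (rule LIMSEQ_imp_Cauchy)
    have "convergent (\<lambda>n. c n b)" if "b \<in> B" for b
    proof (rule Cauchy_convergent, rule CauchyI)
      fix e :: real assume "e > 0"
      \<comment> \<open>The denominator is \<open>K + 1\<close> because \<open>K\<close> can be
        0.\<close>
      then have "e / (K + 1) > 0" using \<open>K \<ge> 0\<close> by simp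
      from CauchyD[OF \<open>Cauchy y\<close> this] obtain N
        where N: "\<And>m n. m \<ge> N \<Longrightarrow> n \<ge> N \<Longrightarrow> norm (y m - y n) < e / (K + 1)" by blast
      have "norm (c m b - c n b) < e" if "m \<ge> N" "n \<ge> N" for m n
      proof -
        have "norm (c m b - c n b) \<le> (\<Sum>b\<in>B. \<bar>c m b - c n b\<bar>)"
          using member_le_sum[of b B "\<lambda>b. \<bar>c m b - c n b\<bar>"] \<open>b \<in> B\<close> insert.hyps(1) by simp
        also have "\<dots> \<le> K * norm (y m - y n)"
          using K[of "\<lambda>b. c m b - c n b"] by (simp add: c scaleR_diff_left sum_subtractf)
        also have "\<dots> \<le> (K + 1) * norm (y m - y n)"
          by (simp add: mult_right_mono)
        also have "\<dots> < e"
          using N[OF that] \<open>K \<ge> 0\<close> by (simp add: field_simps)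
        finally show ?thesis .
      qed
      then show "\<exists>M. \<forall>m\<ge>M. \<forall>n\<ge>M. norm (c m b - c n b) < e" by blast
    qed
    then have "\<forall>b\<in>B. (\<lambda>n. c n b) \<longlonglongrightarrow> lim (\<lambda>n. c n b)"
      by (simp add: convergent_LIMSEQ_iff)
    then have "y \<longlonglongrightarrow> (\<Sum>b\<in>B. lim (\<lambda>n. c n b) *\<^sub>R b)"
      unfolding c by (intro tendsto_sum tendsto_scaleR tendsto_const) auto
    with lim have "- a = (\<Sum>b\<in>B. lim (\<lambda>n. c n b) *\<^sub>R b)"
      by (rule LIMSEQ_unique)
    also have "\<dots> \<in> span B"
      by (intro span_sum span_scale span_base)
    finally show False
      using a span_neg[of "- a" B] by simp
  qed
  \<comment> \<open>The summand \<open>1 / d\<close> accounts for the coefficient of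
    \<open>a\<close>. The factor \<open>1 + norm a / d\<close> compares the norm of the part in
    \<open>span B\<close> with that of the whole vector, and \<open>K\<close> passes from there to
    the coefficients on \<open>B\<close>.\<close>
  have "(\<Sum>b\<in>insert a B. \<bar>c b\<bar>) \<le>
          (1 / d + K * (1 + norm a / d)) * norm (\<Sum>b\<in>insert a B. c b *\<^sub>R b)" for c
  proof -
    define y where "y = (\<Sum>b\<in>B. c b *\<^sub>R b)"
    define x where "x = c a *\<^sub>R a + y"
    have "y \<in> span B"
      unfolding y_def by (intro span_sum span_scale span_base)
    have ca: "\<bar>c a\<bar> \<le> norm x / d"
    proof (cases "c a = 0")
      case False
      have "x = c a *\<^sub>R (a + (1 / c a) *\<^sub>R y)"
        using False by (simp add: x_def scaleR_add_right)
      then have "norm x = \<bar>c a\<bar> * norm (a + (1 / c a) *\<^sub>R y)"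
        by simp
      also have "\<dots> \<ge> \<bar>c a\<bar> * d"
        by (intro mult_left_mono d span_scale \<open>y \<in> span B\<close>) auto
      finally show ?thesis
        using \<open>d > 0\<close> by (simp add: field_simps)
    qed (use \<open>d > 0\<close> in auto)
    have "norm y \<le> norm x + \<bar>c a\<bar> * norm a"
      using norm_triangle_ineq4[of x "c a *\<^sub>R a"] by (simp add: x_def)
    also have "\<dots> \<le> norm x + norm x / d * norm a"
      using mult_right_mono[OF ca norm_ge_zero[of a]] by simp
    finally have "K * norm y \<le> K * (norm x + norm x / d * norm a)"
      using \<open>K \<ge> 0\<close> by (rule mult_left_mono)
    then have "(\<Sum>b\<in>B. \<bar>c b\<bar>) \<le> K * (norm x + norm x / d * norm a)"
      using K[of c] unfolding y_def by linarith
    moreover have "(\<Sum>b\<in>insert a B. \<bar>c b\<bar>) = \<bar>c a\<bar> + (\<Sum>b\<in>B. \<bar>c b\<bar>)"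
      using insert.hyps by simp
    moreover have "(\<Sum>b\<in>insert a B. c b *\<^sub>R b) = x"
      using insert.hyps by (simp add: x_def y_def)
    ultimately show ?thesis
      using ca by (simp add: algebra_simps)
  qed
  then show ?case by blast
qed

text \<open>A single coordinate is dominated by the sum of all of them. For \<open>b\<close> outside
  \<open>B\<close> the value of \<open>representation\<close> is 0 by default, so the functional is
  trivially bounded.\<close>

lemma bounded_linear_representation_finite:
  fixes B :: "'a::real_normed_vector set"
  assumes "finite B" "independent B" "span B = UNIV"
  shows "bounded_linear (\<lambda>x. representation B x b)"
proof -
  obtain K where K: "\<And>c. (\<Sum>b\<in>B. \<bar>c b\<bar>) \<le> K * norm (\<Sum>b\<in>B. c b *\<^sub>R b)"
    using independent_coordinates_bounded[OF assms(1,2)] by blast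
  have bound: "norm (representation B x b) \<le> norm x * \<bar>K\<bar>" for x
  proof (cases "b \<in> B")
    case True
    have "norm (representation B x b) \<le> (\<Sum>b\<in>B. \<bar>representation B x b\<bar>)"
      using member_le_sum[of b B "\<lambda>b. \<bar>representation B x b\<bar>"] True assms(1) by simp
    also have "\<dots> \<le> K * norm x"
      using K[of "representation B x"] sum_representation_eq[of B x B] assms by simp
    also have "\<dots> \<le> norm x * \<bar>K\<bar>"
      by (metis abs_ge_self mult.commute mult_left_mono norm_ge_zero)
    finally show ?thesis .
  next
    case False
    then have "representation B x b = 0"
      using representation_ne_zero by blast
    then show ?thesis by simp
  qed
  show ?thesis
    by (rule bounded_linear_intro[OF _ _ bound])
      (simp_all add: representation_add representation_scale assms)
qed


section \<open>Smooth functions between normed spaces\<close>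

lemma k_smooth_on_subset: "k_smooth_on k S f \<Longrightarrow> T \<subseteq> S \<Longrightarrow> k_smooth_on k T f"
  by (induction k arbitrary: f) (auto intro: continuous_on_subset)

text \<open>The derivative \<open>at x\<close> also looks at points outside \<open>S\<close>; since
  \<open>S\<close> is open, \<open>f\<close> and \<open>g\<close> agree near each of its points and
  so have the same derivatives there.\<close>

lemma k_smooth_on_cong:
  assumes "open S" "\<And>x. x \<in> S \<Longrightarrow> f x = g x" "k_smooth_on k S f"
  shows "k_smooth_on k S g"
  using assms(2,3)
proof (induction k arbitrary: f g)
  case 0
  then show ?case by (simp cong: continuous_on_cong)
next
  case (Suc k)
  have *: "g differentiable (at x)"
      "frechet_derivative f (at x) = frechet_derivative g (at x)" if "x \<in> S" for x
  proof -
    have "(f has_derivative frechet_derivative f (at x)) (at x)"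
      using Suc.prems(2) that by (simp add: frechet_derivative_works)
    then have "(g has_derivative frechet_derivative f (at x)) (at x)"
      by (rule has_derivative_transform_within_open[OF _ assms(1) that]) (rule Suc.prems(1))
    then show "g differentiable (at x)"
        "frechet_derivative f (at x) = frechet_derivative g (at x)"
      by (auto intro: differentiableI frechet_derivative_at)
  qed
  have "k_smooth_on k S (\<lambda>x. frechet_derivative g (at x) v)" for v
    by (rule Suc.IH[of "\<lambda>x. frechet_derivative f (at x) v"]) (use * Suc.prems(2) in auto)
  then show ?case using * by simp
qed

text \<open>Allows smoothness of a composite to be checked with a different intermediate chart near
  each point. Openness of \<open>T\<close> turns continuity on \<open>T\<close> into continuity at
  the point.\<close>

lemma k_smooth_on_local:
  assumes "\<And>x. x \<in> S \<Longrightarrow> \<exists>T. open T \<and> x \<in> T \<and> k_smooth_on k T f"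
  shows "k_smooth_on k S f"
  using assms
proof (induction k arbitrary: f)
  case 0
  then have "isCont f x" if "x \<in> S" for x
    using that by (metis continuous_on_eq_continuous_at k_smooth_on.simps(1))
  then show ?case by (simp add: continuous_at_imp_continuous_on)
next
  case (Suc k)
  have "k_smooth_on k S (\<lambda>x. frechet_derivative f (at x) v)" for v
    by (rule Suc.IH) (use Suc.prems in fastforce)
  moreover have "f differentiable (at x)" if "x \<in> S" for x
    using Suc.prems that by fastforce
  ultimately show ?case by simp
qed

text \<open>The inductive step of the closure properties below: by uniqueness of derivatives, an
  explicit formula \<open>f'\<close> from a differentiation rule can stand for
  \<open>frechet_derivative\<close>.\<close>

lemma k_smooth_on_SucI:
  assumes "open S" "\<And>x. x \<in> S \<Longrightarrow> (f has_derivative f' x) (at x)"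
    and "\<And>v. k_smooth_on k S (\<lambda>x. f' x v)"
  shows "k_smooth_on (Suc k) S f"
proof -
  have "k_smooth_on k S (\<lambda>x. frechet_derivative f (at x) v)" for v
    by (rule k_smooth_on_cong[OF assms(1) _ assms(3)[of v]])
      (simp add: frechet_derivative_at[OF assms(2)])
  then show ?thesis
    using assms(2) by (auto intro: differentiableI)
qed

lemma k_smooth_on_Suc_has_derivative:
  "k_smooth_on (Suc k) S f \<Longrightarrow> x \<in> S \<Longrightarrow> (f has_derivative frechet_derivative f (at x)) (at x)"
  by (simp add: frechet_derivative_works)

lemma k_smooth_on_SucD: "k_smooth_on (Suc k) S f \<Longrightarrow> k_smooth_on k S f"
proof (induction k arbitrary: f)
  case 0
  then show ?case
    by (auto intro!: continuous_at_imp_continuous_on differentiable_imp_continuous_within)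
qed auto

lemma k_smooth_on_const: "k_smooth_on k S (\<lambda>x. c)"
  by (induction k arbitrary: c) (auto simp: frechet_derivative_const)

lemma k_smooth_on_bounded_linear:
  assumes "bounded_linear T" "open S" "k_smooth_on k S f"
  shows "k_smooth_on k S (\<lambda>x. T (f x))"
  using assms(3)
proof (induction k arbitrary: f)
  case 0
  then show ?case
    using bounded_linear.continuous_on[OF assms(1)] by simp
next
  case (Suc k)
  show ?case
    by (rule k_smooth_on_SucI[OF assms(2)
        bounded_linear.has_derivative[OF assms(1) k_smooth_on_Suc_has_derivative[OF Suc.prems]]])
      (use Suc in auto)
qed

lemma k_smooth_on_Pair:
  assumes "open S" "k_smooth_on k S f" "k_smooth_on k S g"
  shows "k_smooth_on k S (\<lambda>x. (f x, g x))"
  using assms(2,3)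
proof (induction k arbitrary: f g)
  case 0
  then show ?case by (auto intro: continuous_on_Pair)
next
  case (Suc k)
  show ?case
    by (rule k_smooth_on_SucI[OF assms(1) has_derivative_Pair[OF
        k_smooth_on_Suc_has_derivative[OF Suc.prems(1)]
        k_smooth_on_Suc_has_derivative[OF Suc.prems(2)]]])
      (use Suc in auto)
qed

lemma k_smooth_on_add:
  assumes "open S" "k_smooth_on k S f" "k_smooth_on k S g"
  shows "k_smooth_on k S (\<lambda>x. f x + g x)"
  using assms(2,3)
proof (induction k arbitrary: f g)
  case 0
  then show ?case by (auto intro: continuous_on_add)
next
  case (Suc k)
  show ?case
    by (rule k_smooth_on_SucI[OF assms(1) has_derivative_add[OF
        k_smooth_on_Suc_has_derivative[OF Suc.prems(1)]
        k_smooth_on_Suc_has_derivative[OF Suc.prems(2)]]])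
      (use Suc in auto)
qed

lemma k_smooth_on_sum:
  assumes "open S" "\<And>i. i \<in> I \<Longrightarrow> k_smooth_on k S (f i)"
  shows "k_smooth_on k S (\<lambda>x. \<Sum>i\<in>I. f i x)"
  using assms(2)
  by (induction I rule: infinite_finite_induct)
    (auto intro: k_smooth_on_const k_smooth_on_add assms(1))

lemma k_smooth_on_bounded_bilinear:
  assumes "bounded_bilinear m" "open S" "k_smooth_on k S f" "k_smooth_on k S g"
  shows "k_smooth_on k S (\<lambda>x. m (f x) (g x))"
  using assms(3,4)
proof (induction k arbitrary: f g)
  case 0
  then show ?case
    using bounded_bilinear.continuous_on[OF assms(1)] by simp
next
  case (Suc k)
  show ?case
  proof (rule k_smooth_on_SucI[OF assms(2) bounded_bilinear.FDERIV[OF assms(1)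
        k_smooth_on_Suc_has_derivative[OF Suc.prems(1)]
        k_smooth_on_Suc_has_derivative[OF Suc.prems(2)]]])
    \<comment> \<open>The product rule pairs each function itself with a derivative of the other, so
      the functions have to be weakened from order \<open>Suc k\<close> to order
      \<open>k\<close>.\<close>
    fix v
    show "k_smooth_on k S (\<lambda>x. m (f x) (frechet_derivative g (at x) v) +
        m (frechet_derivative f (at x) v) (g x))"
      using Suc.prems
      by (intro k_smooth_on_add[OF assms(2)] Suc.IH k_smooth_on_SucD[OF Suc.prems(1)]
          k_smooth_on_SucD[OF Suc.prems(2)]) simp_all
  qed
qed

text \<open>\<open>k_smooth_on\<close> speaks of derivatives in fixed directions, but the chain rule
  produces the derivative of \<open>g\<close> at \<open>f x\<close> in a direction that moves with
  \<open>x\<close>. Finite dimension of the middle space reconciles the two. The induction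
  generalizes over \<open>g\<close>, whose directional derivatives become the new outer
  functions.\<close>

lemma k_smooth_on_compose:
  fixes f :: "'a::real_normed_vector \<Rightarrow> 'b::real_normed_vector"
  assumes fin: "finite B" "span B = (UNIV :: 'b set)"
    and "open S" "f ` S \<subseteq> T" "k_smooth_on k S f" "k_smooth_on k T g"
  shows "k_smooth_on k S (\<lambda>x. g (f x))"
  using assms(5,6)
proof (induction k arbitrary: g)
  case 0
  then show ?case
    using assms(4) continuous_on_compose2 by auto
next
  case (Suc k)
  \<comment> \<open>The spanning set \<open>B\<close> may be dependent; coordinates require a
    basis.\<close>
  obtain C where C: "independent C" "span C = (UNIV :: 'b set)" "finite C"
    using maximal_independent_subset[of B] fin
    by (metis finite_subset span_mono span_span top.extremum_unique)
  \<comment> \<open>Expanding the inner derivative in the basis \<open>C\<close> leaves only directional derivatives of \<open>g\<close>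
    in fixed directions, to which the induction hypothesis applies.\<close>
  have deriv: "((\<lambda>x. g (f x)) has_derivative
      (\<lambda>v. \<Sum>b\<in>C. representation C (frechet_derivative f (at x) v) b *\<^sub>R
        frechet_derivative g (at (f x)) b)) (at x)" if "x \<in> S" for x
  proof -
    have g: "(g has_derivative frechet_derivative g (at (f x))) (at (f x))"
      using k_smooth_on_Suc_has_derivative[OF Suc.prems(2)] that assms(4) by blast
    have expand: "frechet_derivative g (at (f x)) w =
        (\<Sum>b\<in>C. representation C w b *\<^sub>R frechet_derivative g (at (f x)) b)" for w
    proof -
      interpret D: bounded_linear "frechet_derivative g (at (f x))"
        using g by (rule has_derivative_bounded_linear)
      have "w = (\<Sum>b\<in>C. representation C w b *\<^sub>R b)"
        using sum_representation_eq[of C w C] C by simp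
      then have "frechet_derivative g (at (f x)) w =
          frechet_derivative g (at (f x)) (\<Sum>b\<in>C. representation C w b *\<^sub>R b)"
        by simp
      then show ?thesis
        by (simp add: D.sum D.scaleR)
    qed
    show ?thesis
      using has_derivative_compose[OF k_smooth_on_Suc_has_derivative[OF Suc.prems(1) that] g]
      by (subst (asm) expand)
  qed
  show ?case
  proof (rule k_smooth_on_SucI[OF assms(3) deriv])
    fix v
    show "k_smooth_on k S (\<lambda>x. \<Sum>b\<in>C. representation C (frechet_derivative f (at x) v) b *\<^sub>R
        frechet_derivative g (at (f x)) b)"
    proof (intro k_smooth_on_sum[OF assms(3)]
        k_smooth_on_bounded_bilinear[OF bounded_bilinear_scaleR assms(3)])
      fix b
      show "k_smooth_on k S (\<lambda>x. representation C (frechet_derivative f (at x) v) b)"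
        using Suc.prems(1)
        by (intro k_smooth_on_bounded_linear[OF
            bounded_linear_representation_finite[OF C(3,1,2)] assms(3)]) simp
      show "k_smooth_on k S (\<lambda>x. frechet_derivative g (at (f x)) b)"
        by (rule Suc.IH) (use Suc.prems k_smooth_on_SucD in auto)
    qed
  qed
qed


section \<open>Smooth maps\<close>

text \<open>The properties of charts on which composition of smooth maps relies. Isolating them from
  \<open>smooth_manifold\<close> lets the product and the model space be treated without verifying
  all manifold axioms for them.\<close>

definition open_charts :: "('a, 'e::real_normed_vector) manifold \<Rightarrow> bool" where
  "open_charts M \<longleftrightarrow>
     (\<Union>(U, \<phi>)\<in>atlas M. U) = topspace (topology_of M) \<and>
     (\<forall>(U, \<phi>)\<in>atlas M. openin (topology_of M) U \<and> inj_on \<phi> U \<and>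
        (\<forall>W. openin (topology_of M) W \<and> W \<subseteq> U \<longrightarrow> open (\<phi> ` W)))"

lemma open_charts_cover:
  assumes "open_charts M" "p \<in> topspace (topology_of M)"
  obtains U \<phi> where "(U, \<phi>) \<in> atlas M" "p \<in> U"
proof -
  have "p \<in> (\<Union>(U, \<phi>)\<in>atlas M. U)"
    using assms by (simp add: open_charts_def)
  then show ?thesis using that by auto
qed

lemma open_chartsD:
  assumes "open_charts M" "(U, \<phi>) \<in> atlas M"
  shows "openin (topology_of M) U" "inj_on \<phi> U"
    and "\<And>W. openin (topology_of M) W \<Longrightarrow> W \<subseteq> U \<Longrightarrow> open (\<phi> ` W)"
  using assms by (auto simp: open_charts_def)

lemma open_charts_smooth_manifold:
  assumes "smooth_manifold M"
  shows "open_charts M"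
  unfolding open_charts_def
proof (intro conjI ballI, goal_cases)
  case 1
  then show ?case using assms by (simp add: smooth_manifold_def)
next
  case (2 c)
  obtain U \<phi> where c: "c = (U, \<phi>)" by (cases c)
  have U: "openin (topology_of M) U" "open (\<phi> ` U)"
    and hom: "homeomorphic_map (subtopology (topology_of M) U) (top_of_set (\<phi> ` U)) \<phi>"
    using assms 2 by (auto simp: smooth_manifold_def c)
  have top: "topspace (subtopology (topology_of M) U) = U"
    using openin_subset[OF U(1)] by (rule topspace_subtopology_subset)
  have "open (\<phi> ` W)" if "openin (topology_of M) W" "W \<subseteq> U" for W
  proof -
    have "openin (subtopology (topology_of M) U) W"
      using that U(1) by (simp add: openin_open_subtopology)
    then have "openin (top_of_set (\<phi> ` U)) (\<phi> ` W)"
      using homeomorphic_map_openness[OF hom] that(2) unfolding top by blast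
    then show ?thesis
      using U(2) openin_open_eq by blast
  qed
  then show ?case
    using U(1) homeomorphic_imp_injective_map[OF hom] top by (simp add: c)
qed

lemma open_charts_euclidean: "open_charts euclidean_manifold"
  by (auto simp: open_charts_def euclidean_manifold_def)

text \<open>An open subset of a product chart contains an open box around each of its points, and a
  product chart sends a box to a product of open sets.\<close>

lemma open_charts_prod:
  assumes "open_charts M" "open_charts N"
  shows "open_charts (prod_manifold M N)"
  unfolding open_charts_def
proof (intro conjI ballI, goal_cases)
  case 1
  show ?case
  proof (intro equalityI subsetI)
    fix p assume "p \<in> (\<Union>(U, \<phi>)\<in>atlas (prod_manifold M N). U)"
    then obtain U \<phi> V \<psi> where "(U, \<phi>) \<in> atlas M" "(V, \<psi>) \<in> atlas N" "p \<in> U \<times> V"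
      by (auto simp: prod_manifold_def)
    then show "p \<in> topspace (topology_of (prod_manifold M N))"
      using open_chartsD(1)[OF assms(1), THEN openin_subset]
        open_chartsD(1)[OF assms(2), THEN openin_subset]
      by (fastforce simp: prod_manifold_def)
  next
    fix p assume "p \<in> topspace (topology_of (prod_manifold M N))"
    then have p: "fst p \<in> topspace (topology_of M)" "snd p \<in> topspace (topology_of N)"
      by (auto simp: prod_manifold_def)
    obtain U \<phi> where U: "(U, \<phi>) \<in> atlas M" "fst p \<in> U"
      using open_charts_cover[OF assms(1) p(1)] .
    obtain V \<psi> where V: "(V, \<psi>) \<in> atlas N" "snd p \<in> V"
      using open_charts_cover[OF assms(2) p(2)] .
    have "(U \<times> V, map_prod \<phi> \<psi>) \<in> atlas (prod_manifold M N)" "p \<in> U \<times> V"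
      using U V by (auto simp: prod_manifold_def mem_Times_iff)
    then show "p \<in> (\<Union>(U, \<phi>)\<in>atlas (prod_manifold M N). U)"
      by blast
  qed
next
  case (2 c)
  then obtain U \<phi> V \<psi>
    where c: "c = (U \<times> V, map_prod \<phi> \<psi>)" and U: "(U, \<phi>) \<in> atlas M" and V: "(V, \<psi>) \<in> atlas N"
    by (auto simp: prod_manifold_def)
  note U' = open_chartsD[OF assms(1) U] and V' = open_chartsD[OF assms(2) V]
  have "open (map_prod \<phi> \<psi> ` W)"
    if W: "openin (prod_topology (topology_of M) (topology_of N)) W" "W \<subseteq> U \<times> V" for W
  proof (rule open_prod_intro)
    fix q assume "q \<in> map_prod \<phi> \<psi> ` W"
    then obtain x y where xy: "(x, y) \<in> W" "q = (\<phi> x, \<psi> y)" by auto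
    obtain A B where AB: "openin (topology_of M) A" "openin (topology_of N) B"
        "x \<in> A" "y \<in> B" "A \<times> B \<subseteq> W"
      using openin_prod_topology_alt[THEN iffD1, OF W(1), rule_format, OF xy(1)] by blast
    have "A \<subseteq> U" "B \<subseteq> V"
      using AB(3-5) W(2) by blast+
    moreover have "\<phi> ` A \<times> \<psi> ` B \<subseteq> map_prod \<phi> \<psi> ` W"
      using AB(5) by (force simp: image_iff)
    ultimately show "\<exists>A B. open A \<and> open B \<and> q \<in> A \<times> B \<and> A \<times> B \<subseteq> map_prod \<phi> \<psi> ` W"
      using U'(3)[OF AB(1)] V'(3)[OF AB(2)] AB(3,4) xy(2) by blast
  qed
  then show ?case
    using U'(1,2) V'(1,2)
    by (simp add: c prod_manifold_def openin_prod_Times_iff map_prod_inj_on)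
qed

text \<open>Translations factor through \<open>prod_manifold M M\<close>, so the chain rule is
  applied with the product of two model spaces in the middle.\<close>

lemma finite_span_prod:
  assumes "finite A" "span A = (UNIV :: 'a::real_vector set)"
    and "finite B" "span B = (UNIV :: 'b::real_vector set)"
  shows "\<exists>C::('a \<times> 'b) set. finite C \<and> span C = UNIV"
proof (intro exI conjI)
  let ?C = "(\<lambda>a. (a, 0)) ` A \<union> (\<lambda>b. (0, b)) ` B"
  show "finite ?C" using assms by simp
  have "linear (\<lambda>a::'a. (a, 0::'b))" "linear (\<lambda>b::'b. (0::'a, b))"
    by (auto intro!: linearI)
  then have "span ((\<lambda>a. (a, 0)) ` A) = range (\<lambda>a. (a, 0::'b))"
      "span ((\<lambda>b. (0, b)) ` B) = range (\<lambda>b. (0::'a, b))"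
    using assms by (simp_all add: linear_span_image)
  then have "(a, 0) \<in> span ?C" "(0, b) \<in> span ?C" for a b
    using span_mono[of "(\<lambda>a. (a, 0)) ` A" ?C] span_mono[of "(\<lambda>b. (0, b)) ` B" ?C] by auto
  then have "(a, 0) + (0, b) \<in> span ?C" for a b
    by (rule span_add)
  then show "span ?C = UNIV" by auto
qed

lemma smooth_map_domain_open:
  assumes "open_charts M" "continuous_map (topology_of M) (topology_of N) F"
    and "(U, \<phi>) \<in> atlas M" "openin (topology_of N) V"
  shows "openin (topology_of M) (U \<inter> F -` V)" "open (\<phi> ` (U \<inter> F -` V))"
proof -
  have "U \<inter> F -` V = {x \<in> U. F x \<in> V}" by auto
  then show "openin (topology_of M) (U \<inter> F -` V)"
    using openin_continuous_map_preimage_gen[OF assms(2) open_chartsD(1)[OF assms(1,3)] assms(4)]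
    by simp
  then show "open (\<phi> ` (U \<inter> F -` V))"
    using open_chartsD(3)[OF assms(1,3)] by simp
qed

text \<open>Near a point \<open>x\<close>, the coordinate expression of the composite factors
  through a chart of \<open>N\<close> around \<open>F x\<close>, where the chain rule between normed
  spaces applies.\<close>

lemma smooth_map_compose:
  fixes N :: "('b, 'f::real_normed_vector) manifold"
  assumes M: "open_charts M" and N: "open_charts N" and P: "open_charts P"
    and fin: "finite B" "span B = (UNIV :: 'f set)"
    and F: "smooth_map M N F" and g: "smooth_map N P g"
  shows "smooth_map M P (g \<circ> F)"
proof -
  have contF: "continuous_map (topology_of M) (topology_of N) F"
    and contg: "continuous_map (topology_of N) (topology_of P) g"
    using F g by (auto simp: smooth_map_def)
  have contgF: "continuous_map (topology_of M) (topology_of P) (g \<circ> F)"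
    using contF contg by (rule continuous_map_compose)
  have "k_smooth_on k (\<phi> ` (U \<inter> (g \<circ> F) -` W)) (\<theta> \<circ> (g \<circ> F) \<circ> inv_into U \<phi>)"
    if U: "(U, \<phi>) \<in> atlas M" and W: "(W, \<theta>) \<in> atlas P" for U \<phi> W \<theta> k
  proof (rule k_smooth_on_local)
    fix y assume "y \<in> \<phi> ` (U \<inter> (g \<circ> F) -` W)"
    then obtain x where x: "x \<in> U" "g (F x) \<in> W" "y = \<phi> x" by auto
    have "x \<in> topspace (topology_of M)"
      using x(1) open_chartsD(1)[OF M U] openin_subset by blast
    then have "F x \<in> topspace (topology_of N)"
      using contF continuous_map_funspace by fast
    then obtain V \<psi> where V: "(V, \<psi>) \<in> atlas N" "F x \<in> V"
      by (rule open_charts_cover[OF N])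
    let ?f = "\<psi> \<circ> F \<circ> inv_into U \<phi>" and ?g = "\<theta> \<circ> g \<circ> inv_into V \<psi>"
    \<comment> \<open>On \<open>S\<close> the intermediate value lies in \<open>V\<close> and the
      final one in \<open>W\<close>, so both factors and the composite have coordinate expressions
      in the chosen charts.\<close>
    define S where "S = U \<inter> F -` V \<inter> (U \<inter> (g \<circ> F) -` W)"
    have "openin (topology_of M) S"
      unfolding S_def
      by (intro openin_Int smooth_map_domain_open(1)[OF M contF U open_chartsD(1)[OF N V(1)]]
          smooth_map_domain_open(1)[OF M contgF U open_chartsD(1)[OF P W]])
    then have "open (\<phi> ` S)"
      using open_chartsD(3)[OF M U] by (simp add: S_def le_infI1)
    have inv: "inv_into U \<phi> (\<phi> z) = z" if "z \<in> U" for z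
      using open_chartsD(2)[OF M U] that by simp
    have "k_smooth_on k (\<phi> ` (U \<inter> F -` V)) ?f"
      using F U V(1) by (fastforce simp: smooth_map_def smooth_on_def)
    then have smf: "k_smooth_on k (\<phi> ` S) ?f"
      by (rule k_smooth_on_subset) (auto simp: S_def)
    have smg: "k_smooth_on k (\<psi> ` (V \<inter> g -` W)) ?g"
      using g W V(1) by (fastforce simp: smooth_map_def smooth_on_def)
    have "?f ` \<phi> ` S \<subseteq> \<psi> ` (V \<inter> g -` W)"
      by (auto simp: S_def inv)
    then have comp: "k_smooth_on k (\<phi> ` S) (\<lambda>z. ?g (?f z))"
      by (rule k_smooth_on_compose[OF fin \<open>open (\<phi> ` S)\<close> _ smf smg])
    \<comment> \<open>On \<open>S\<close> the chart \<open>\<psi>\<close> is followed by its own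
      inverse and cancels.\<close>
    have "?g (?f z) = (\<theta> \<circ> (g \<circ> F) \<circ> inv_into U \<phi>) z" if "z \<in> \<phi> ` S" for z
      using that open_chartsD(2)[OF N V(1)] by (auto simp: S_def inv)
    then have "k_smooth_on k (\<phi> ` S) (\<theta> \<circ> (g \<circ> F) \<circ> inv_into U \<phi>)"
      using comp by (rule k_smooth_on_cong[OF \<open>open (\<phi> ` S)\<close>])
    moreover have "y \<in> \<phi> ` S"
      using x V(2) by (auto simp: S_def)
    ultimately show "\<exists>T. open T \<and> y \<in> T \<and>
        k_smooth_on k T (\<theta> \<circ> (g \<circ> F) \<circ> inv_into U \<phi>)"
      using \<open>open (\<phi> ` S)\<close> by blast
  qed
  then show ?thesis
    using contgF by (auto simp: smooth_map_def smooth_on_def)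
qed

text \<open>Composing multiplication with these maps gives the translations. In charts each is a
  transition map of \<open>M\<close> paired with a constant.\<close>

lemma smooth_map_Pair_const:
  assumes M: "smooth_manifold M" and a: "a \<in> topspace (topology_of M)"
  shows "smooth_map M (prod_manifold M M) (\<lambda>x. (x, a))"
    and "smooth_map M (prod_manifold M M) (\<lambda>x. (a, x))"
proof -
  have *: "open (\<phi> ` (U \<inter> V))" "k_smooth_on k (\<phi> ` (U \<inter> V)) (\<psi> \<circ> inv_into U \<phi>)"
    if "(U, \<phi>) \<in> atlas M" "(V, \<psi>) \<in> atlas M" for U \<phi> V \<psi> k
  proof -
    show "open (\<phi> ` (U \<inter> V))"
      using open_chartsD[OF open_charts_smooth_manifold[OF M] that(1)]
        open_chartsD[OF open_charts_smooth_manifold[OF M] that(2)] by blast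
    show "k_smooth_on k (\<phi> ` (U \<inter> V)) (\<psi> \<circ> inv_into U \<phi>)"
      using M that by (fastforce simp: smooth_manifold_def smooth_on_def)
  qed
  \<comment> \<open>The domain is \<open>U \<inter> V\<close> if \<open>a\<close> lies in
    \<open>V'\<close> and empty otherwise; in both cases it is a subset of
    \<open>U \<inter> V\<close>.\<close>
  have 1: "k_smooth_on k (\<phi> ` (U \<inter> (\<lambda>x. (x, a)) -` (V \<times> V')))
      (map_prod \<psi> \<psi>' \<circ> (\<lambda>x. (x, a)) \<circ> inv_into U \<phi>)"
    if "(U, \<phi>) \<in> atlas M" "(V, \<psi>) \<in> atlas M" for U \<phi> V \<psi> V' \<psi>' k
    by (rule k_smooth_on_subset[of _ "\<phi> ` (U \<inter> V)"])
      (use k_smooth_on_Pair[OF * k_smooth_on_const[of _ _ "\<psi>' a"], OF that that]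
        in \<open>auto simp: o_def\<close>)
  have 2: "k_smooth_on k (\<phi> ` (U \<inter> (\<lambda>x. (a, x)) -` (V' \<times> V)))
      (map_prod \<psi>' \<psi> \<circ> (\<lambda>x. (a, x)) \<circ> inv_into U \<phi>)"
    if "(U, \<phi>) \<in> atlas M" "(V, \<psi>) \<in> atlas M" for U \<phi> V \<psi> V' \<psi>' k
    by (rule k_smooth_on_subset[of _ "\<phi> ` (U \<inter> V)"])
      (use k_smooth_on_Pair[OF *(1) k_smooth_on_const[of _ _ "\<psi>' a"] *(2), OF that that]
        in \<open>auto simp: o_def\<close>)
  have "continuous_map (topology_of M) (topology_of (prod_manifold M M)) (\<lambda>x. (x, a))"
      "continuous_map (topology_of M) (topology_of (prod_manifold M M)) (\<lambda>x. (a, x))"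
    using a by (simp_all add: prod_manifold_def continuous_map_pairwise o_def)
  moreover have "\<exists>V \<psi> V' \<psi>'. c = (V \<times> V', map_prod \<psi> \<psi>') \<and> (V, \<psi>) \<in> atlas M \<and> (V', \<psi>') \<in> atlas M"
    if "c \<in> atlas (prod_manifold M M)" for c
    using that by (auto simp: prod_manifold_def)
  ultimately show "smooth_map M (prod_manifold M M) (\<lambda>x. (x, a))"
      and "smooth_map M (prod_manifold M M) (\<lambda>x. (a, x))"
    unfolding smooth_map_def smooth_on_def using 1 2 by fast+
qed

section \<open>The algebra of smooth functions and its pull-backs\<close>

lemma smooth_functions_iff:
  "f \<in> smooth_functions M \<longleftrightarrow>
     continuous_map (topology_of M) euclideanreal f \<and>
     (\<forall>(U, \<phi>)\<in>atlas M. \<forall>k. k_smooth_on k (\<phi> ` U) (\<lambda>x. f (inv_into U \<phi> x)))"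
  by (simp add: smooth_functions_def smooth_map_def smooth_on_def euclidean_manifold_def o_def)

lemma open_chart_image: "open_charts M \<Longrightarrow> (U, \<phi>) \<in> atlas M \<Longrightarrow> open (\<phi> ` U)"
  using open_chartsD by blast

text \<open>Both continuity and the coordinate expressions read a function only at points of the
  manifold.\<close>

lemma smooth_functions_cong:
  assumes M: "open_charts M" and eq: "\<And>p. p \<in> topspace (topology_of M) \<Longrightarrow> f p = g p"
    and f: "f \<in> smooth_functions M"
  shows "g \<in> smooth_functions M"
proof -
  have "k_smooth_on k (\<phi> ` U) (\<lambda>x. g (inv_into U \<phi> x))" if U: "(U, \<phi>) \<in> atlas M" for U \<phi> k
  proof (rule k_smooth_on_cong[OF open_chart_image[OF M U]])
    show "k_smooth_on k (\<phi> ` U) (\<lambda>x. f (inv_into U \<phi> x))"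
      using f U by (auto simp: smooth_functions_iff)
    show "f (inv_into U \<phi> x) = g (inv_into U \<phi> x)" if "x \<in> \<phi> ` U" for x
      using that open_chartsD(1)[OF M U, THEN openin_subset] inv_into_into[of x \<phi> U]
      by (intro eq) blast
  qed
  moreover have "continuous_map (topology_of M) euclideanreal g"
    using f eq by (auto simp: smooth_functions_iff intro: continuous_map_eq)
  ultimately show ?thesis
    by (auto simp: smooth_functions_iff)
qed

lemma smooth_functions_const: "(\<lambda>x. c) \<in> smooth_functions M"
  by (auto simp: smooth_functions_iff k_smooth_on_const)

lemma smooth_functions_add:
  assumes "open_charts M" "f \<in> smooth_functions M" "g \<in> smooth_functions M"
  shows "f + g \<in> smooth_functions M"
proof -
  have "continuous_map (topology_of M) euclideanreal (\<lambda>p. f p + g p)"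
    using assms by (intro continuous_map_add) (auto simp: smooth_functions_iff)
  moreover have "k_smooth_on k (\<phi> ` U) (\<lambda>x. f (inv_into U \<phi> x) + g (inv_into U \<phi> x))"
    if "(U, \<phi>) \<in> atlas M" for U \<phi> k
    using assms that
    by (intro k_smooth_on_add open_chart_image) (auto simp: smooth_functions_iff)
  ultimately show ?thesis
    by (auto simp: smooth_functions_iff plus_fun_def)
qed

lemma smooth_functions_mult:
  assumes "open_charts M" "f \<in> smooth_functions M" "g \<in> smooth_functions M"
  shows "f * g \<in> smooth_functions M"
proof -
  have "continuous_map (topology_of M) euclideanreal (\<lambda>p. f p * g p)"
    using assms by (intro continuous_map_real_mult) (auto simp: smooth_functions_iff)
  moreover have "k_smooth_on k (\<phi> ` U) (\<lambda>x. f (inv_into U \<phi> x) * g (inv_into U \<phi> x))"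
    if "(U, \<phi>) \<in> atlas M" for U \<phi> k
    using assms that
    by (intro k_smooth_on_bounded_bilinear[OF bounded_bilinear_mult] open_chart_image)
      (auto simp: smooth_functions_iff)
  ultimately show ?thesis
    by (auto simp: smooth_functions_iff times_fun_def)
qed

lemma smooth_functions_scaleR:
  assumes "open_charts M" "f \<in> smooth_functions M"
  shows "c *\<^sub>R f \<in> smooth_functions M"
proof -
  have "c *\<^sub>R f = (\<lambda>x. c) * f" by (simp add: fun_eq_iff)
  then show ?thesis
    using smooth_functions_mult[OF assms(1) smooth_functions_const assms(2)] by simp
qed

lemma smooth_functions_compose:
  fixes N :: "('a, 'b::real_normed_vector) manifold"
  assumes "open_charts M" "smooth_manifold N" "smooth_map M N F" "f \<in> smooth_functions N"
  shows "f \<circ> F \<in> smooth_functions M"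
proof -
  obtain B :: "'b set" where "finite B" "span B = UNIV"
    using assms(2) by (auto simp: smooth_manifold_def)
  then show ?thesis
    using smooth_map_compose[OF assms(1) open_charts_smooth_manifold[OF assms(2)]
        open_charts_euclidean] assms(3,4)
    by (simp add: smooth_functions_def)
qed

section \<open>Push-forward of vectors and bivectors\<close>

text \<open>
  Identities between composites of translations hold on the carrier only, so push-forwards along
  them agree only on vectors that ignore the values of functions off the manifold.
\<close>

definition supported_vec :: "('a, 'e::real_normed_vector) manifold \<Rightarrow> 'a vec \<Rightarrow> bool" where
  "supported_vec M X \<longleftrightarrow>
     (\<forall>f. f \<notin> smooth_functions M \<longrightarrow> X f = 0) \<and>
     (\<forall>f g. (\<forall>p\<in>topspace (topology_of M). f p = g p) \<longrightarrow> X f = X g)"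

definition supported_bivec :: "('a, 'e::real_normed_vector) manifold \<Rightarrow> 'a bivec \<Rightarrow> bool" where
  "supported_bivec M B \<longleftrightarrow>
     (\<forall>f g. f \<notin> smooth_functions M \<or> g \<notin> smooth_functions M \<longrightarrow> B f g = 0) \<and>
     (\<forall>f f' g g'. (\<forall>p\<in>topspace (topology_of M). f p = f' p \<and> g p = g' p) \<longrightarrow> B f g = B f' g')"

lemma supported_vec_cong:
  assumes "supported_vec M X" "\<And>p. p \<in> topspace (topology_of M) \<Longrightarrow> f p = g p"
  shows "X f = X g"
  using assms by (simp add: supported_vec_def)

lemma supported_bivec_cong:
  assumes "supported_bivec M B" "\<And>p. p \<in> topspace (topology_of M) \<Longrightarrow> f p = f' p"
    and "\<And>p. p \<in> topspace (topology_of M) \<Longrightarrow> g p = g' p"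
  shows "B f g = B f' g'"
  using assms by (simp add: supported_bivec_def)

text \<open>For a function vanishing on the manifold, the Leibniz rule is applied to its product
  with the indicator \<open>e\<close> of the complement, which is smooth because it is 0 on the
  manifold. The general case follows by taking the difference of the two functions.\<close>

lemma supported_vec_tangent:
  assumes M: "smooth_manifold M" and p: "p \<in> topspace (topology_of M)"
    and X: "X \<in> tangent_space M p"
  shows "supported_vec M X"
proof -
  note oc = open_charts_smooth_manifold[OF M]
  have zero: "X f = 0" if f: "\<forall>q\<in>topspace (topology_of M). f q = 0" for f
  proof -
    define e where "e = (\<lambda>q. if q \<in> topspace (topology_of M) then 0 else 1 :: real)"
    have smooth: "f \<in> smooth_functions M" "e \<in> smooth_functions M"
      by (rule smooth_functions_cong[OF oc _ smooth_functions_const[of 0]]; simp add: f e_def)+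
    have "f = f * e"
      using f by (auto simp: e_def fun_eq_iff)
    then have "X f = X (f * e)" by simp
    also have "\<dots> = f p * X e + X f * e p"
      using X smooth unfolding tangent_space_def by blast
    also have "\<dots> = 0"
      using f p by (simp add: e_def)
    finally show ?thesis .
  qed
  have "X f = X g" if eq: "\<forall>q\<in>topspace (topology_of M). f q = g q" for f g
  \<comment> \<open>Additivity of \<open>X\<close> is available on smooth functions only. If
    \<open>f\<close> is not smooth, neither is \<open>g\<close>, and both values are the default
    0.\<close>
  proof (cases "f \<in> smooth_functions M")
    case True
    have d: "g - f \<in> smooth_functions M"
      by (rule smooth_functions_cong[OF oc _ smooth_functions_const[of 0]]) (simp add: eq)
    have "X g = X (f + (g - f))" by simp
    also have "\<dots> = X f + X (g - f)"
      using X True d unfolding tangent_space_def by blast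
    also have "X (g - f) = 0"
      by (rule zero) (simp add: eq)
    finally show ?thesis by simp
  next
    case False
    moreover have "g \<notin> smooth_functions M"
      using smooth_functions_cong[OF oc, of g f] eq False by auto
    ultimately show ?thesis
      using X by (simp add: tangent_space_def)
  qed
  then show ?thesis
    using X by (auto simp: supported_vec_def tangent_space_def)
qed

lemma supported_vec_velocity:
  assumes "open_charts M" "range \<gamma> \<subseteq> topspace (topology_of M)"
  shows "supported_vec M (velocity M \<gamma>)"
proof -
  have "velocity M \<gamma> f = velocity M \<gamma> g"
    if eq: "\<forall>p\<in>topspace (topology_of M). f p = g p" for f g
  proof -
    have "f \<in> smooth_functions M \<longleftrightarrow> g \<in> smooth_functions M"
      using smooth_functions_cong[OF assms(1), of f g] smooth_functions_cong[OF assms(1), of g f] eq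
      by auto
    moreover have "(\<lambda>t. f (\<gamma> t)) = (\<lambda>t. g (\<gamma> t))"
      using assms(2) eq by blast
    ultimately show ?thesis by (simp add: velocity_def)
  qed
  then show ?thesis
    unfolding supported_vec_def by (auto simp: velocity_def)
qed

text \<open>The supported bivectors form a subspace, so it suffices to look at decomposable
  elements.\<close>

lemma supported_bivec_wedge_space:
  assumes "\<And>X. X \<in> V \<Longrightarrow> supported_vec M X" "\<And>Y. Y \<in> W \<Longrightarrow> supported_vec M Y"
    and "B \<in> wedge_space V W"
  shows "supported_bivec M B"
proof -
  have wedge: "supported_bivec M (wedge X Y)" if "X \<in> V" "Y \<in> W" for X Y
  proof -
    have X: "supported_vec M X" and Y: "supported_vec M Y" using assms(1,2) that by auto
    have "wedge X Y f g = wedge X Y f' g'"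
      if "\<forall>p\<in>topspace (topology_of M). f p = f' p \<and> g p = g' p" for f f' g g'
      using supported_vec_cong[OF X, of f f'] supported_vec_cong[OF X, of g g']
        supported_vec_cong[OF Y, of f f'] supported_vec_cong[OF Y, of g g'] that
      by (simp add: wedge_def)
    moreover have "wedge X Y f g = 0" if "f \<notin> smooth_functions M \<or> g \<notin> smooth_functions M" for f g
      using X Y that by (auto simp: wedge_def supported_vec_def)
    ultimately show ?thesis
      unfolding supported_bivec_def by blast
  qed
  have sub: "subspace (Collect (supported_bivec M))"
    unfolding subspace_def
  proof (intro conjI ballI allI; unfold mem_Collect_eq)
    show "supported_bivec M 0"
      by (simp add: supported_bivec_def zero_fun_def)
    show "supported_bivec M (A + C)" if A: "supported_bivec M A" and C: "supported_bivec M C" for A C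
    proof -
      have "(A + C) f g = (A + C) f' g'"
        if "\<forall>p\<in>topspace (topology_of M). f p = f' p \<and> g p = g' p" for f f' g g'
        using supported_bivec_cong[OF A, of f f' g g'] supported_bivec_cong[OF C, of f f' g g'] that
        by simp
      then show ?thesis
        using A C by (simp add: supported_bivec_def)
    qed
    show "supported_bivec M (c *\<^sub>R A)" if A: "supported_bivec M A" for c A
    proof -
      have "(c *\<^sub>R A) f g = (c *\<^sub>R A) f' g'"
        if "\<forall>p\<in>topspace (topology_of M). f p = f' p \<and> g p = g' p" for f f' g g'
        using supported_bivec_cong[OF A, of f f' g g'] that by simp
      then show ?thesis
        using A by (simp add: supported_bivec_def)
    qed
  qed
  have "wedge_space V W \<subseteq> Collect (supported_bivec M)"
    unfolding wedge_space_def by (rule span_minimal[OF _ sub]) (use wedge in auto)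
  then show ?thesis using assms(3) by auto
qed

lemma supported_bivec_field:
  assumes "smooth_manifold M" "bivector_field M \<rho>" "p \<in> topspace (topology_of M)"
  shows "supported_bivec M (\<rho> p)"
proof (rule supported_bivec_wedge_space)
  show "\<rho> p \<in> wedge_space (tangent_space M p) (tangent_space M p)"
    using assms by (simp add: bivector_field_def)
qed (fact supported_vec_tangent[OF assms(1,3)])+

section \<open>Functoriality of push-forward and its effect on tangent vectors\<close>

lemma supported_bivec_push:
  fixes M :: "('a, 'e::real_normed_vector) manifold"
  assumes "smooth_manifold M" "F \<in> topspace (topology_of M) \<rightarrow> topspace (topology_of M)"
    and "supported_bivec M B"
  shows "supported_bivec M (push_bivec M F B)"
  unfolding supported_bivec_def
proof (intro conjI allI impI)
  fix f f' g g' :: "'a \<Rightarrow> real"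
  assume eq: "\<forall>p\<in>topspace (topology_of M). f p = f' p \<and> g p = g' p"
  note cong = smooth_functions_cong[OF open_charts_smooth_manifold[OF assms(1)]]
  have "f \<in> smooth_functions M \<longleftrightarrow> f' \<in> smooth_functions M"
      "g \<in> smooth_functions M \<longleftrightarrow> g' \<in> smooth_functions M"
    using cong[of f f'] cong[of f' f] cong[of g g'] cong[of g' g] eq by auto
  moreover have "\<forall>p\<in>topspace (topology_of M). (f \<circ> F) p = (f' \<circ> F) p \<and> (g \<circ> F) p = (g' \<circ> F) p"
    using eq assms(2) by (simp add: Pi_iff)
  then have "B (f \<circ> F) (g \<circ> F) = B (f' \<circ> F) (g' \<circ> F)"
    using assms(3) unfolding supported_bivec_def by blast
  ultimately show "push_bivec M F B f g = push_bivec M F B f' g'"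
    by (simp add: push_bivec_def)
qed (auto simp: push_bivec_def)

text \<open>Smoothness of the outer map \<open>F\<close> keeps \<open>f \<circ> F\<close> smooth, so
  that the inner push-forward does not fall back to its default value 0.\<close>

lemma push_bivec_compose:
  assumes "smooth_manifold M" "smooth_map M M F"
  shows "push_bivec M F (push_bivec M K B) = push_bivec M (F \<circ> K) B"
proof -
  have "f \<circ> F \<in> smooth_functions M" if "f \<in> smooth_functions M" for f
    using smooth_functions_compose[OF open_charts_smooth_manifold[OF assms(1)] assms that] .
  then show ?thesis
    by (auto simp: push_bivec_def fun_eq_iff comp_assoc)
qed

lemma push_bivec_cong:
  assumes "supported_bivec M B" "\<And>p. p \<in> topspace (topology_of M) \<Longrightarrow> F p = K p"
  shows "push_bivec M F B = push_bivec M K B"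
proof -
  have "B (f \<circ> F) (g \<circ> F) = B (f \<circ> K) (g \<circ> K)" for f g
    by (rule supported_bivec_cong[OF assms(1)]) (simp_all add: assms(2))
  then show ?thesis
    by (auto simp: push_bivec_def fun_eq_iff)
qed

lemma push_bivec_ident:
  assumes "supported_bivec M B" "\<And>p. p \<in> topspace (topology_of M) \<Longrightarrow> F p = p"
  shows "push_bivec M F B = B"
proof -
  have "push_bivec M F B = push_bivec M id B"
    using assms by (intro push_bivec_cong) auto
  also have "\<dots> = B"
    using assms(1) by (auto simp: push_bivec_def supported_bivec_def fun_eq_iff)
  finally show ?thesis .
qed

lemma linear_push_bivec: "linear (push_bivec M F)"
  by (rule linearI) (auto simp: push_bivec_def fun_eq_iff)

lemma push_bivec_wedge_space:
  assumes "\<And>X. X \<in> V \<Longrightarrow> push_vec M F X \<in> V'" "\<And>Y. Y \<in> W \<Longrightarrow> push_vec M F Y \<in> W'"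
    and "B \<in> wedge_space V W"
  shows "push_bivec M F B \<in> wedge_space V' W'"
proof -
  let ?S = "{wedge X Y | X Y. X \<in> V \<and> Y \<in> W}" and ?S' = "{wedge X Y | X Y. X \<in> V' \<and> Y \<in> W'}"
  have "push_bivec M F ` ?S \<subseteq> ?S'"
    using assms(1,2) by (force simp: push_bivec_wedge)
  then have "span (push_bivec M F ` ?S) \<subseteq> span ?S'"
    by (rule span_mono)
  then show ?thesis
    using assms(3) unfolding wedge_space_def linear_span_image[OF linear_push_bivec] by blast
qed

lemma push_vec_tangent_space:
  assumes M: "smooth_manifold M" and F: "smooth_map M M F" and X: "X \<in> tangent_space M p"
  shows "push_vec M F X \<in> tangent_space M (F p)"
proof -
  note oc = open_charts_smooth_manifold[OF M]
  have comp: "f \<circ> F \<in> smooth_functions M" if "f \<in> smooth_functions M" for f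
    using smooth_functions_compose[OF oc M F that] .
  have [simp]: "(f + g) \<circ> F = (f \<circ> F) + (g \<circ> F)" "(f * g) \<circ> F = (f \<circ> F) * (g \<circ> F)"
      "(c *\<^sub>R f) \<circ> F = c *\<^sub>R (f \<circ> F)" for f g :: "_ \<Rightarrow> real" and c
    by (auto simp: fun_eq_iff)
  show ?thesis
    using X comp smooth_functions_add[OF oc] smooth_functions_mult[OF oc]
      smooth_functions_scaleR[OF oc]
    by (simp add: tangent_space_def push_vec_def)
qed

lemma push_vec_velocity:
  assumes "smooth_manifold M" "smooth_map M M F"
  shows "push_vec M F (velocity M \<gamma>) = velocity M (F \<circ> \<gamma>)"
  using smooth_functions_compose[OF open_charts_smooth_manifold[OF assms(1)] assms]
  by (auto simp: push_vec_def velocity_def fun_eq_iff)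


section \<open>Conjugation in a Lie group\<close>

context lie_group
begin

section \<open>Smoothness of translations and conjugations, and their action on subgroups\<close>

lemma smooth_map_mult:
  assumes "a \<in> carrier G"
  shows "smooth_map M M (\<lambda>x. x \<otimes> a)" and "smooth_map M M (\<lambda>x. a \<otimes> x)"
proof -
  obtain B :: "'e set" where "finite B" "span B = UNIV"
    using manifold by (auto simp: smooth_manifold_def)
  then obtain C :: "('e \<times> 'e) set" where C: "finite C" "span C = UNIV"
    using finite_span_prod by blast
  note oc = open_charts_smooth_manifold[OF manifold]
  note comp = smooth_map_compose[OF oc open_charts_prod[OF oc oc] oc C _ smooth_mult]
  have a: "a \<in> topspace (topology_of M)"
    using assms by (simp add: topspace_eq)
  show "smooth_map M M (\<lambda>x. x \<otimes> a)" "smooth_map M M (\<lambda>x. a \<otimes> x)"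
    using comp[OF smooth_map_Pair_const(1)[OF manifold a]]
      comp[OF smooth_map_Pair_const(2)[OF manifold a]] by (simp_all add: o_def)
qed

text \<open>The domain is a general \<open>N\<close> to cover curves, which start from
  \<open>euclidean_manifold\<close>, as well as self-maps of \<open>M\<close>.\<close>

lemma smooth_map_comp:
  assumes "open_charts N" "smooth_map N M F" "smooth_map M M K"
  shows "smooth_map N M (\<lambda>x. K (F x))"
proof -
  obtain B :: "'e set" where "finite B" "span B = UNIV"
    using manifold by (auto simp: smooth_manifold_def)
  from smooth_map_compose[OF assms(1) open_charts_smooth_manifold[OF manifold]
      open_charts_smooth_manifold[OF manifold] this assms(2,3)]
  show ?thesis by (simp add: o_def)
qed

lemma smooth_map_conj:
  assumes "a \<in> carrier G" "b \<in> carrier G"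
  shows "smooth_map M M (\<lambda>x. a \<otimes> x \<otimes> b)"
  using smooth_map_comp[OF open_charts_smooth_manifold[OF manifold]
      smooth_map_mult(2)[OF assms(1)] smooth_map_mult(1)[OF assms(2)]] .

lemma inv_mult_cancel:
  assumes "x \<in> carrier G" "y \<in> carrier G"
  shows "inv x \<otimes> (x \<otimes> y) = y" "x \<otimes> (inv x \<otimes> y) = y"
  using assms by (simp_all flip: m_assoc)

lemma conj_conj:
  assumes "\<sigma> \<in> carrier G" "x \<in> carrier G"
  shows "inv \<sigma> \<otimes> (\<sigma> \<otimes> x \<otimes> inv \<sigma>) \<otimes> \<sigma> = x"
  using assms by (simp add: m_assoc inv_mult_cancel)

text \<open>The conjugate is a subgroup as the image of \<open>H\<close> under a homomorphism, and
  closed as the preimage of \<open>H\<close> under the inverse conjugation, which is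
  continuous.\<close>

lemma closed_subgroup_conj:
  assumes H: "closed_subgroup G M H" and \<sigma>: "\<sigma> \<in> carrier G"
  shows "closed_subgroup G M ((\<lambda>h. \<sigma> \<otimes> h \<otimes> inv \<sigma>) ` H)" (is "closed_subgroup G M ?K")
proof -
  have sub: "subgroup H G" and H_carr: "H \<subseteq> carrier G"
    using H by (auto simp: closed_subgroup_def subgroup_def)
  interpret c: group_hom G G "\<lambda>h. \<sigma> \<otimes> h \<otimes> inv \<sigma>"
    using \<sigma> by unfold_locales (auto simp: hom_def m_assoc inv_mult_cancel)
  have "subgroup ?K G"
    using c.subgroup_img_is_subgroup[OF sub] .
  moreover have "?K = {x \<in> topspace (topology_of M). inv \<sigma> \<otimes> x \<otimes> \<sigma> \<in> H}"
  proof (intro equalityI subsetI)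
    fix x assume "x \<in> ?K"
    then show "x \<in> {x \<in> topspace (topology_of M). inv \<sigma> \<otimes> x \<otimes> \<sigma> \<in> H}"
      using conj_conj[OF \<sigma>] H_carr \<sigma> by (auto simp: topspace_eq subset_iff)
  next
    fix x assume "x \<in> {x \<in> topspace (topology_of M). inv \<sigma> \<otimes> x \<otimes> \<sigma> \<in> H}"
    then have "x = \<sigma> \<otimes> (inv \<sigma> \<otimes> x \<otimes> \<sigma>) \<otimes> inv \<sigma>" "inv \<sigma> \<otimes> x \<otimes> \<sigma> \<in> H"
      using conj_conj[of "inv \<sigma>" x] \<sigma> by (auto simp: topspace_eq)
    then show "x \<in> ?K" by blast
  qed
  moreover have "continuous_map (topology_of M) (topology_of M) (\<lambda>x. inv \<sigma> \<otimes> x \<otimes> \<sigma>)"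
    using smooth_map_conj[of "inv \<sigma>" \<sigma>] \<sigma> by (simp add: smooth_map_def)
  then have "closedin (topology_of M) {x \<in> topspace (topology_of M). inv \<sigma> \<otimes> x \<otimes> \<sigma> \<in> H}"
    using H by (intro closedin_continuous_map_preimage) (auto simp: closed_subgroup_def)
  ultimately show ?thesis
    by (simp add: closed_subgroup_def)
qed

text \<open>Conjugating by \<open>inv \<sigma>\<close> carries a smooth curve in the conjugate of
  \<open>H\<close> to one in \<open>H\<close>, still through \<open>\<one>\<close>, and push-forward
  carries velocity to velocity.\<close>

lemma push_vec_conj_lie_algebra:
  assumes \<sigma>: "\<sigma> \<in> carrier G" and H: "H \<subseteq> carrier G"
    and X: "X \<in> lie_algebra_of G M ((\<lambda>h. \<sigma> \<otimes> h \<otimes> inv \<sigma>) ` H)"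
  shows "push_vec M (\<lambda>x. inv \<sigma> \<otimes> x \<otimes> \<sigma>) X \<in> lie_algebra_of G M H"
proof -
  let ?c = "\<lambda>x. inv \<sigma> \<otimes> x \<otimes> \<sigma>"
  obtain \<gamma> where \<gamma>: "X = velocity M \<gamma>" "smooth_map euclidean_manifold M \<gamma>" "\<gamma> 0 = \<one>"
      "range \<gamma> \<subseteq> (\<lambda>h. \<sigma> \<otimes> h \<otimes> inv \<sigma>) ` H"
    using X by (auto simp: lie_algebra_of_def)
  have c: "smooth_map M M ?c"
    using smooth_map_conj \<sigma> by simp
  have "range (?c \<circ> \<gamma>) \<subseteq> H"
  proof (intro subsetI, elim rangeE)
    fix x t assume "x = (?c \<circ> \<gamma>) t"
    moreover obtain h where "h \<in> H" "\<gamma> t = \<sigma> \<otimes> h \<otimes> inv \<sigma>"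
      using \<gamma>(4) by blast
    ultimately show "x \<in> H"
      using conj_conj[OF \<sigma>] H by auto
  qed
  moreover have "smooth_map euclidean_manifold M (?c \<circ> \<gamma>)"
    using smooth_map_comp[OF open_charts_euclidean \<gamma>(2) c] by (simp add: o_def)
  moreover have "(?c \<circ> \<gamma>) 0 = \<one>"
    using \<gamma>(3) \<sigma> by simp
  ultimately show ?thesis
    unfolding \<gamma>(1) push_vec_velocity[OF manifold c] lie_algebra_of_def by blast
qed

text \<open>The second factor is preserved because conjugation is smooth and fixes
  \<open>\<one>\<close>.\<close>

lemma push_bivec_conj_wedge_space:
  assumes \<sigma>: "\<sigma> \<in> carrier G" and H: "H \<subseteq> carrier G"
    and B: "B \<in> wedge_space (lie_algebra_of G M ((\<lambda>h. \<sigma> \<otimes> h \<otimes> inv \<sigma>) ` H)) (tangent_space M \<one>)"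
  shows "push_bivec M (\<lambda>x. inv \<sigma> \<otimes> x \<otimes> \<sigma>) B \<in>
           wedge_space (lie_algebra_of G M H) (tangent_space M \<one>)"
proof (rule push_bivec_wedge_space[OF _ _ B])
  show "push_vec M (\<lambda>x. inv \<sigma> \<otimes> x \<otimes> \<sigma>) Y \<in> tangent_space M \<one>" if "Y \<in> tangent_space M \<one>" for Y
    using push_vec_tangent_space[OF manifold smooth_map_conj[of "inv \<sigma>" \<sigma>] that] \<sigma> by simp
qed (rule push_vec_conj_lie_algebra[OF \<sigma> H])

lemma supported_bivec_lie_algebra:
  assumes "H \<subseteq> carrier G" "B \<in> wedge_space (lie_algebra_of G M H) (tangent_space M \<one>)"
  shows "supported_bivec M B"
proof (rule supported_bivec_wedge_space[OF _ _ assms(2)])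
  show "supported_vec M X" if "X \<in> lie_algebra_of G M H" for X
  proof -
    obtain \<gamma> where "X = velocity M \<gamma>" "range \<gamma> \<subseteq> H"
      using \<open>X \<in> lie_algebra_of G M H\<close> by (auto simp: lie_algebra_of_def)
    then show ?thesis
      using supported_vec_velocity[OF open_charts_smooth_manifold[OF manifold]] assms(1)
      by (simp add: topspace_eq)
  qed
  show "supported_vec M Y" if "Y \<in> tangent_space M \<one>" for Y
    using supported_vec_tangent[OF manifold _ that] by (simp add: topspace_eq)
qed

section \<open>Right translations, twisting and coisotropy\<close>

lemma right_translation_compose:
  assumes "a \<in> carrier G" "b \<in> carrier G" "supported_bivec M B"
  shows "right_translation G M b (right_translation G M a B) = right_translation G M (a \<otimes> b) B"
  unfolding right_translation_def push_bivec_compose[OF manifold smooth_map_mult(1)[OF assms(2)]]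
  by (rule push_bivec_cong[OF assms(3)]) (use assms in \<open>simp add: topspace_eq m_assoc\<close>)

lemma supported_bivec_right_translation:
  assumes "a \<in> carrier G" "supported_bivec M B"
  shows "supported_bivec M (right_translation G M a B)"
  unfolding right_translation_def
  by (rule supported_bivec_push[OF manifold _ assms(2)]) (use assms(1) in \<open>simp add: topspace_eq\<close>)

text \<open>Formulated for any family of supported bivectors, so that it also applies to a field
  that is already twisted.\<close>

lemma coisotropic_subgroup_twist:
  assumes \<sigma>: "\<sigma> \<in> carrier G" and H: "closed_subgroup G M H"
    and \<pi>: "\<And>g. g \<in> carrier G \<Longrightarrow> supported_bivec M (\<pi> g)"
    and co: "coisotropic_subgroup G M \<pi> ((\<lambda>h. \<sigma> \<otimes> h \<otimes> inv \<sigma>) ` H)"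
  shows "coisotropic_subgroup G M (twist G M \<pi> \<sigma>) H"
  unfolding coisotropic_subgroup_def
proof (intro conjI ballI)
  fix g h assume g: "g \<in> carrier G" and h: "h \<in> H"
  have H_carr: "H \<subseteq> carrier G"
    using H by (auto simp: closed_subgroup_def subgroup_def)
  \<comment> \<open>Coisotropy of the conjugate is used at \<open>?k\<close> and \<open>?c\<close>:
    these are chosen so that \<open>?k\<close> and \<open>?k \<otimes> ?c\<close> are the points
    where \<open>twist\<close> evaluates \<open>\<pi>\<close> for \<open>g\<close> and
    \<open>g \<otimes> h\<close>.\<close>
  let ?k = "g \<otimes> inv \<sigma>" and ?c = "\<sigma> \<otimes> h \<otimes> inv \<sigma>"
  have carr [simp]: "g \<in> carrier G" "\<sigma> \<in> carrier G" "h \<in> carrier G"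
    using g \<sigma> h H_carr by auto
  have k: "?k \<in> carrier G" and c: "?c \<in> carrier G" by simp_all
  have kc: "?k \<otimes> ?c = g \<otimes> h \<otimes> inv \<sigma>"
    by (simp add: m_assoc inv_mult_cancel)
  obtain w where
    w: "w \<in> wedge_space (lie_algebra_of G M ((\<lambda>h. \<sigma> \<otimes> h \<otimes> inv \<sigma>) ` H)) (tangent_space M \<one>)"
    and eq: "\<pi> (?k \<otimes> ?c) - right_translation G M ?c (\<pi> ?k) = left_translation G M (?k \<otimes> ?c) w"
    using co k h unfolding coisotropic_subgroup_def by blast
  have supp: "supported_bivec M w"
    by (rule supported_bivec_lie_algebra[OF _ w]) (use H_carr \<sigma> in auto)
  \<comment> \<open>Both sides translate by \<open>\<sigma> \<otimes> h\<close>, which equals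
    \<open>?c \<otimes> \<sigma>\<close>.\<close>
  have "right_translation G M h (twist G M \<pi> \<sigma> g) =
      right_translation G M \<sigma> (right_translation G M ?c (\<pi> ?k))"
    by (simp add: twist_def right_translation_compose \<pi> m_assoc)
  then have "twist G M \<pi> \<sigma> (g \<otimes> h) - right_translation G M h (twist G M \<pi> \<sigma> g) =
      right_translation G M \<sigma> (\<pi> (?k \<otimes> ?c) - right_translation G M ?c (\<pi> ?k))"
    unfolding kc by (simp add: twist_def right_translation_def linear_diff[OF linear_push_bivec])
  also have "\<dots> = push_bivec M ((\<lambda>x. x \<otimes> \<sigma>) \<circ> (\<lambda>x. g \<otimes> h \<otimes> inv \<sigma> \<otimes> x)) w"
    unfolding eq unfolding kc left_translation_def right_translation_def
    by (rule push_bivec_compose[OF manifold smooth_map_mult(1)[OF \<sigma>]])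
  \<comment> \<open>Associativity identifies the two maps on the carrier only; \<open>supp\<close>
    makes that enough.\<close>
  also have "\<dots> = push_bivec M ((\<lambda>x. g \<otimes> h \<otimes> x) \<circ> (\<lambda>x. inv \<sigma> \<otimes> x \<otimes> \<sigma>)) w"
    by (rule push_bivec_cong[OF supp]) (simp add: topspace_eq m_assoc)
  also have "\<dots> = left_translation G M (g \<otimes> h) (push_bivec M (\<lambda>x. inv \<sigma> \<otimes> x \<otimes> \<sigma>) w)"
    unfolding left_translation_def
    by (rule push_bivec_compose[OF manifold smooth_map_mult(2), symmetric]) simp
  finally show "twist G M \<pi> \<sigma> (g \<otimes> h) - right_translation G M h (twist G M \<pi> \<sigma> g) \<in>
      left_translation G M (g \<otimes> h) ` wedge_space (lie_algebra_of G M H) (tangent_space M \<one>)"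
    using push_bivec_conj_wedge_space[OF \<sigma> H_carr w] by blast
qed (rule H)

text \<open>The two translations combine to translation by \<open>\<one>\<close>, which is the
  identity on supported bivectors, and the shifts of the base point cancel.\<close>

lemma twist_twist_inv:
  assumes "\<sigma> \<in> carrier G" "g \<in> carrier G" "supported_bivec M (\<pi> g)"
  shows "twist G M (twist G M \<pi> \<sigma>) (inv \<sigma>) g = \<pi> g"
proof -
  have "twist G M (twist G M \<pi> \<sigma>) (inv \<sigma>) g =
      right_translation G M (inv \<sigma>) (right_translation G M \<sigma> (\<pi> g))"
    using assms by (simp add: twist_def m_assoc)
  also have "\<dots> = right_translation G M \<one> (\<pi> g)"
    using assms by (simp add: right_translation_compose)
  also have "\<dots> = \<pi> g"
    unfolding right_translation_def
    by (rule push_bivec_ident[OF assms(3)]) (simp add: topspace_eq)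
  finally show ?thesis .
qed

text \<open>Needed because twisting back recovers the original field only at points of the
  carrier.\<close>

lemma coisotropic_subgroup_cong:
  assumes "\<And>g. g \<in> carrier G \<Longrightarrow> \<rho> g = \<rho>' g" "coisotropic_subgroup G M \<rho> H"
  shows "coisotropic_subgroup G M \<rho>' H"
proof -
  have "H \<subseteq> carrier G"
    using assms(2) by (auto simp: coisotropic_subgroup_def closed_subgroup_def subgroup_def)
  then show ?thesis
    using assms by (simp add: coisotropic_subgroup_def subset_iff)
qed

end

theorem theorem3:
  fixes G :: "('a, 'm) monoid_scheme"
    and M :: "('a, 'e::real_normed_vector) manifold"
    and \<pi> :: "'a \<Rightarrow> 'a bivec"
    and H :: "'a set"
    and \<sigma> :: 'a
  assumes "lie_group G M"
    and "poisson_tensor M \<pi>"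
    and "closed_subgroup G M H"
    and "\<sigma> \<in> carrier G"
  shows "coisotropic_subgroup G M \<pi> ((\<lambda>h. \<sigma> \<otimes>\<^bsub>G\<^esub> h \<otimes>\<^bsub>G\<^esub> inv\<^bsub>G\<^esub> \<sigma>) ` H) \<longleftrightarrow>
         coisotropic_subgroup G M (twist G M \<pi> \<sigma>) H"
proof -
  interpret lie_group G M by (rule assms(1))
  let ?K = "(\<lambda>h. \<sigma> \<otimes>\<^bsub>G\<^esub> h \<otimes>\<^bsub>G\<^esub> inv\<^bsub>G\<^esub> \<sigma>) ` H"
  have supp: "supported_bivec M (\<pi> g)" if "g \<in> carrier G" for g
    using supported_bivec_field[OF manifold, of \<pi> g] assms(2) that
    by (simp add: poisson_tensor_def topspace_eq)
  show ?thesis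
  proof
    assume "coisotropic_subgroup G M \<pi> ?K"
    then show "coisotropic_subgroup G M (twist G M \<pi> \<sigma>) H"
      using coisotropic_subgroup_twist[OF assms(4,3)] supp by blast
  next
    assume co: "coisotropic_subgroup G M (twist G M \<pi> \<sigma>) H"
    have H_carr: "H \<subseteq> carrier G"
      using assms(3) by (auto simp: closed_subgroup_def subgroup_def)
    \<comment> \<open>\<open>H\<close> is rewritten as the conjugate of \<open>?K\<close> by the
      inverse of \<open>\<sigma>\<close>, so that \<open>coisotropic_subgroup_twist\<close> can be
      used with \<open>?K\<close> as its subgroup.\<close>
    have "(\<lambda>x. inv\<^bsub>G\<^esub> \<sigma> \<otimes>\<^bsub>G\<^esub> x \<otimes>\<^bsub>G\<^esub> inv\<^bsub>G\<^esub> (inv\<^bsub>G\<^esub> \<sigma>)) ` ?K = (\<lambda>h. h) ` H"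
      unfolding image_image
      by (rule image_cong[OF refl]) (use conj_conj assms(4) H_carr in auto)
    with co have co': "coisotropic_subgroup G M (twist G M \<pi> \<sigma>)
        ((\<lambda>x. inv\<^bsub>G\<^esub> \<sigma> \<otimes>\<^bsub>G\<^esub> x \<otimes>\<^bsub>G\<^esub> inv\<^bsub>G\<^esub> (inv\<^bsub>G\<^esub> \<sigma>)) ` ?K)"
      by simp
    \<comment> \<open>Right translation preserves support, which is the condition on the twisted
      field in the second use of \<open>coisotropic_subgroup_twist\<close>.\<close>
    have "supported_bivec M (twist G M \<pi> \<sigma> g)" if "g \<in> carrier G" for g
      unfolding twist_def
      by (intro supported_bivec_right_translation supp) (use assms(4) that in simp_all)
    then have "coisotropic_subgroup G M (twist G M (twist G M \<pi> \<sigma>) (inv\<^bsub>G\<^esub> \<sigma>)) ?K"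
      using coisotropic_subgroup_twist[OF inv_closed[OF assms(4)]
          closed_subgroup_conj[OF assms(3,4)] _ co'] by blast
    then show "coisotropic_subgroup G M \<pi> ?K"
      using coisotropic_subgroup_cong[of "twist G M (twist G M \<pi> \<sigma>) (inv\<^bsub>G\<^esub> \<sigma>)" \<pi>]
        twist_twist_inv[OF assms(4)] supp by blast
  qed
qed

end
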